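(* Let $T\in B(H)$, $\|T\|\le 1$, and let $\varepsilon>0$ be fixed. Let $(\lambda_n)_{n=1}^\infty\subset \mathrm{Int}\,W_e(T)$, and let $(\mu_n)_{n=1}^\infty,(\nu_n)_{n=1}^\infty\subset\mathbb C$ satisfy $$\mathrm{dist}\{\lambda_n,\partial W_e(T)\}>2\varepsilon\quad\text{for all } n\in\mathbb N,\qquad\text{and}\qquad \sup_{n\ge1}\max\{|\mu_n|,|\nu_n|\}<\frac{\varepsilon\sqrt{\varepsilon}}{16}.$$ Then there exists an orthonormal basis $(u_n)_{n=1}^\infty$ in $H$ such that for all $n\in\mathbb N$: (i) $\langle Tu_n,u_n\rangle=\lambda_n$; (ii) $\langle Tu_n,u_{n+1}\rangle=\mu_n$; (iii) $\langle Tu_{n+1},u_n\rangle=\nu_n$.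
   Context: $H$ is a separable infinite-dimensional complex Hilbert space and $B(H)$ is the space of bounded linear operators on $H$. $\mathbb N=\{1,2,\dots\}$. The essential numerical range $W_e(T)\subset\mathbb C$ of $T\in B(H)$ is the set of all $\lambda\in\mathbb C$ for which there exists an orthonormal sequence $(e_n)_{n=1}^\infty\subset H$ with $\langle Te_n,e_n\rangle\to\lambda$ as $n\to\infty$ (it is a nonempty, compact, convex set). $\mathrm{Int}\,W_e(T)$ and $\partial W_e(T)$ are its interior and boundary in $\mathbb C$, and $\mathrm{dist}\{\lambda,A\}=\inf_{a\in A}|\lambda-a|$. *)

theory Defs
  imports "HOL-Analysis.Analysis"
begin

text \<open>
  Complex Hilbert spaces, layered over the real inner product spaces of the library: norm,
  metric and topology are the library's ones, and the axiom \<open>Re_cinner\<close> says that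
  the real inner product is the real part of the complex one, so that
  \<open>(norm x)\<^sup>2\<close> equals \<open>cinner x x\<close>.
  The complex inner product is linear in its first and antilinear in its second argument.
\<close>

class complex_vector = real_vector +
  fixes scaleC :: "complex \<Rightarrow> 'a \<Rightarrow> 'a"  (infixr \<open>*\<^sub>C\<close> 75)
  assumes scaleC_add_right: "a *\<^sub>C (x + y) = a *\<^sub>C x + a *\<^sub>C y"
    and scaleC_add_left: "(a + b) *\<^sub>C x = a *\<^sub>C x + b *\<^sub>C x"
    and scaleC_scaleC: "a *\<^sub>C (b *\<^sub>C x) = (a * b) *\<^sub>C x"
    and scaleC_one: "1 *\<^sub>C x = x"
    and scaleR_scaleC: "r *\<^sub>R x = complex_of_real r *\<^sub>C x"

class complex_inner = complex_vector + real_inner +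
  fixes cinner :: "'a \<Rightarrow> 'a \<Rightarrow> complex"
  assumes cinner_commute: "cinner x y = cnj (cinner y x)"
    and cinner_add_left: "cinner (x + y) z = cinner x z + cinner y z"
    and cinner_scaleC_left: "cinner (c *\<^sub>C x) y = c * cinner x y"
    and Re_cinner: "Re (cinner x y) = inner x y"

class chilbert_space = complex_inner + complete_space

global_interpretation complex_vector: vector_space "scaleC :: complex \<Rightarrow> 'a \<Rightarrow> 'a :: complex_vector"
  defines cspan = complex_vector.span
  by unfold_locales (auto simp: scaleC_add_right scaleC_add_left scaleC_scaleC scaleC_one)

lemma cinner_self:
  fixes x :: "'a :: complex_inner"
  shows "cinner x x = complex_of_real ((norm x)\<^sup>2)"
proof -
  have "Im (cinner x x) = 0"
    using arg_cong[OF cinner_commute[of x x], of Im] by simp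
  then show ?thesis
    by (simp add: complex_eq_iff Re_cinner power2_norm_eq_inner)
qed

instantiation complex :: chilbert_space
begin

definition scaleC_complex :: "complex \<Rightarrow> complex \<Rightarrow> complex"
  where "scaleC_complex a x = a * x"

definition cinner_complex :: "complex \<Rightarrow> complex \<Rightarrow> complex"
  where "cinner_complex x y = x * cnj y"

instance
  by standard
    (auto simp: scaleC_complex_def cinner_complex_def algebra_simps scaleR_conv_of_real
      inner_complex_def)

end

definition bounded_clinear :: "('a :: complex_inner \<Rightarrow> 'b :: complex_inner) \<Rightarrow> bool"
  where "bounded_clinear T \<longleftrightarrow> bounded_linear T \<and> (\<forall>c x. T (c *\<^sub>C x) = c *\<^sub>C T x)"

text \<open>Sequences are indexed from 0.\<close>

definition orthonormal_seq :: "(nat \<Rightarrow> 'a :: complex_inner) \<Rightarrow> bool"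
  where "orthonormal_seq e \<longleftrightarrow> (\<forall>m n. cinner (e m) (e n) = (if m = n then 1 else 0))"

definition orthonormal_basis_seq :: "(nat \<Rightarrow> 'a :: complex_inner) \<Rightarrow> bool"
  where "orthonormal_basis_seq e \<longleftrightarrow> orthonormal_seq e \<and> closure (cspan (range e)) = UNIV"

definition essential_numerical_range :: "('a :: complex_inner \<Rightarrow> 'a) \<Rightarrow> complex set"
  where "essential_numerical_range T =
    {l. \<exists>e. orthonormal_seq e \<and> (\<lambda>n. cinner (T (e n)) (e n)) \<longlonglongrightarrow> l}"

end

theory Submission
  imports Defs
begin

text \<open>
  The basis is built one vector at a time. An orthonormal sequence converges weakly to
  \<open>0\<close>, so a point of the essential numerical range is approximated by the values of the
  form \<open>cinner (T x) x\<close> at unit vectors \<open>x\<close> that are decoupled from any given finite set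
  \<open>F\<close>: orthogonal to \<open>F\<close>, to \<open>T ` F\<close> and, after applying \<open>T\<close>, again to \<open>F\<close>
  (\<open>decoupled_unit_vector_near\<close>). Combining four such vectors that are also decoupled from
  each other turns approximate into exact values at points that have a disc around them in
  the range (\<open>decoupled_unit_vector\<close>).

  A new basis vector has three parts. The first is a short step of length \<open>s\<close> towards a
  vector \<open>y\<close> that is to be approximated. The second repairs the two entries
  with the preceding basis vector \<open>u\<close>; for this, \<open>u\<close> was given a component taken from an
  orthonormal triple on which \<open>T\<close> acts as a multiple of the identity plus a cyclic shift
  (\<open>cyclic_triple\<close>), and the other two vectors of that triple were kept in reserve. The
  third part, which carries most of the norm, is decoupled from everything before. It gives
  the correct diagonal entry, since the error caused by the two short parts is smaller than
  the distance to the boundary (\<open>extension_step\<close>).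

  Every vector of a countable dense set is taken as \<open>y\<close> infinitely often, and each time
  the new basis vector has with \<open>y\<close> an inner product at least \<open>s\<close> times the distance of
  \<open>y\<close> from the span of its predecessors. By Bessel's inequality these inner products tend
  to \<open>0\<close>, so \<open>y\<close> lies in the closed span of the basis
  (\<open>orthonormal_basis_if_captures\<close>).
\<close>

section \<open>Complex inner products\<close>

lemma cinner_add_right: "cinner x (y + z) = cinner x y + cinner x z"
  by (metis cinner_commute cinner_add_left complex_cnj_add)

lemma cinner_scaleC_right: "cinner x (c *\<^sub>C y) = cnj c * cinner x y"
  by (metis cinner_commute cinner_scaleC_left complex_cnj_mult)

lemma cinner_zero_left [simp]: "cinner 0 x = 0"
  using cinner_add_left[of 0 0 x] by simp

lemma cinner_zero_right [simp]: "cinner x 0 = 0"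
  using cinner_add_right[of x 0 0] by simp

lemma cinner_diff_left: "cinner (x - y) z = cinner x z - cinner y z"
  using cinner_add_left[of "x - y" y z] by simp

lemma cinner_diff_right: "cinner z (x - y) = cinner z x - cinner z y"
  using cinner_add_right[of z "x - y" y] by simp

lemma cinner_sum_left: "cinner (sum f A) x = (\<Sum>i\<in>A. cinner (f i) x)"
  by (induction A rule: infinite_finite_induct) (auto simp: cinner_add_left)

lemma cinner_sum_right: "cinner x (sum f A) = (\<Sum>i\<in>A. cinner x (f i))"
  by (induction A rule: infinite_finite_induct) (auto simp: cinner_add_right)

lemmas cinner_linear =
  cinner_add_left cinner_add_right cinner_diff_left cinner_diff_right
  cinner_scaleC_left cinner_scaleC_right

lemma cinner_eq_0_sym: "cinner x y = 0 \<Longrightarrow> cinner y x = 0"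
  by (metis cinner_commute complex_cnj_zero)

lemma cinner_unit: "norm x = 1 \<Longrightarrow> cinner x x = 1"
  by (simp add: cinner_self)

lemma norm_unit_if_cinner: "cinner x x = 1 \<Longrightarrow> norm x = 1"
  by (metis cinner_self norm_ge_zero of_real_eq_1_iff power2_eq_1_iff
      abs_norm_cancel abs_of_nonneg real_sqrt_abs real_sqrt_one)

lemma norm_scaleC [simp]:
  fixes x :: "'a :: complex_inner"
  shows "norm (c *\<^sub>C x) = cmod c * norm x"
proof -
  have "cinner (c *\<^sub>C x) (c *\<^sub>C x) = c * cnj c * cinner x x"
    by (simp add: cinner_linear)
  then have "complex_of_real ((norm (c *\<^sub>C x))\<^sup>2) = complex_of_real ((cmod c * norm x)\<^sup>2)"
    by (simp only: cinner_self complex_norm_square[symmetric] power_mult_distrib of_real_mult)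
  then show ?thesis
    by (simp only: of_real_eq_iff) (simp add: power2_eq_iff_nonneg)
qed

lemma norm_cinner_le: "cmod (cinner x y) \<le> norm x * norm y"
proof -
  obtain c where c: "cmod c = 1" "c * cinner x y = complex_of_real (cmod (cinner x y))"
  proof (cases "cinner x y = 0")
    case True
    then show ?thesis using that[of 1] by simp
  next
    case False
    then show ?thesis
      using that[of "cnj (cinner x y) / cmod (cinner x y)"]
      by (simp add: norm_divide complex_norm_square[symmetric] power2_eq_square mult.commute)
  qed
  have "cmod (cinner x y) = inner (c *\<^sub>C x) y"
    by (simp add: Re_cinner[symmetric] cinner_linear c)
  also have "\<dots> \<le> norm (c *\<^sub>C x) * norm y"
    by (rule norm_cauchy_schwarz)
  finally show ?thesis by (simp add: c)
qed

text \<open>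
  Taking \<open>b = a\<close> expands inner products in an orthonormal family; taking
  \<open>b i = T (a i)\<close> says that a family on which the form of \<open>T\<close> is diagonal turns
  squared moduli of coefficients into weights of the values \<open>w i\<close>.
\<close>

lemma cinner_sum_diagonal:
  assumes "finite A"
    and "\<And>i j. i \<in> A \<Longrightarrow> j \<in> A \<Longrightarrow> cinner (b i) (a j) = (if i = j then w i else 0)"
  shows "cinner (\<Sum>i\<in>A. c i *\<^sub>C b i) (\<Sum>i\<in>A. d i *\<^sub>C a i) = (\<Sum>i\<in>A. c i * cnj (d i) * w i)"
proof -
  have "cinner (\<Sum>i\<in>A. c i *\<^sub>C b i) (\<Sum>i\<in>A. d i *\<^sub>C a i) =
      (\<Sum>i\<in>A. \<Sum>j\<in>A. c i * (cnj (d j) * (if i = j then w i else 0)))"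
    unfolding cinner_sum_left cinner_sum_right
    by (intro sum.cong refl) (simp add: cinner_linear assms(2))
  also have "\<dots> = (\<Sum>i\<in>A. c i * cnj (d i) * w i)"
    using assms(1) by (intro sum.cong refl) (simp add: if_distrib sum.delta cong: if_cong)
  finally show ?thesis .
qed

lemma bounded_clinear_add: "bounded_clinear S \<Longrightarrow> S (x + y) = S x + S y"
  by (simp add: bounded_clinear_def bounded_linear.linear linear_add)

lemma bounded_clinear_diff: "bounded_clinear S \<Longrightarrow> S (x - y) = S x - S y"
  by (simp add: bounded_clinear_def bounded_linear.linear linear_diff)

lemma bounded_clinear_scaleC: "bounded_clinear S \<Longrightarrow> S (c *\<^sub>C x) = c *\<^sub>C S x"
  by (simp add: bounded_clinear_def)

lemma bounded_clinear_sum: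
  "bounded_clinear S \<Longrightarrow> S (\<Sum>i\<in>A. c i *\<^sub>C a i) = (\<Sum>i\<in>A. c i *\<^sub>C S (a i))"
  by (simp add: bounded_clinear_def bounded_linear.linear linear_sum)

lemmas bounded_clinear_linear =
  bounded_clinear_add bounded_clinear_diff bounded_clinear_scaleC

lemma bounded_clinear_ident: "bounded_clinear (\<lambda>x. x)"
  by (simp add: bounded_clinear_def bounded_linear_ident)

lemma bounded_clinear_cinner:
  assumes "bounded_clinear S"
  shows "bounded_clinear (\<lambda>x. cinner (S x) v)"
proof -
  obtain K where K: "\<And>x. norm (S x) \<le> norm x * K"
    using assms bounded_linear.bounded unfolding bounded_clinear_def by blast
  have "bounded_linear (\<lambda>x. cinner (S x) v)"
  proof (rule bounded_linear_intro)
    fix x :: 'a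
    show "norm (cinner (S x) v) \<le> norm x * (K * norm v)"
      using order_trans[OF norm_cinner_le mult_right_mono[OF K norm_ge_zero]]
      by (simp add: mult.assoc)
  qed (simp_all add: assms bounded_clinear_linear cinner_linear scaleR_scaleC scaleC_complex_def)
  then show ?thesis
    by (simp add: bounded_clinear_def assms bounded_clinear_linear cinner_linear
        bounded_clinear_scaleC[OF assms] scaleC_complex_def)
qed

text \<open>
  Bessel's inequality for a functional: testing \<open>\<phi>\<close> on the vector with coefficients
  \<open>cnj (\<phi> (e n))\<close> bounds the sum of the \<open>(cmod (\<phi> (e n)))\<^sup>2\<close> by the squared norm of
  \<open>\<phi>\<close>. No representing vector is involved, so the lemma also serves for
  \<open>x \<mapsto> cinner (T x) v\<close> without the adjoint of \<open>T\<close>.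
\<close>

lemma functional_orthonormal_tendsto_0:
  fixes \<phi> :: "'a :: complex_inner \<Rightarrow> complex"
  assumes \<phi>: "bounded_clinear \<phi>" and e: "orthonormal_seq e"
  shows "(\<lambda>n. \<phi> (e n)) \<longlonglongrightarrow> 0"
proof -
  obtain K where K: "\<And>x. norm (\<phi> x) \<le> norm x * K"
    using \<phi> bounded_linear.bounded unfolding bounded_clinear_def by blast
  have bound: "(\<Sum>n<N. (cmod (\<phi> (e n)))\<^sup>2) \<le> K\<^sup>2" for N
  proof -
    define s where "s = (\<Sum>n<N. (cmod (\<phi> (e n)))\<^sup>2)"
    define x where "x = (\<Sum>n<N. cnj (\<phi> (e n)) *\<^sub>C e n)"
    have "\<phi> x = complex_of_real s"
      unfolding x_def bounded_clinear_sum[OF \<phi>] s_def of_real_sum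
      by (intro sum.cong refl)
        (simp only: scaleC_complex_def complex_norm_square mult.commute)
    moreover have s0: "s \<ge> 0" by (simp add: s_def sum_nonneg)
    ultimately have 1: "s \<le> norm x * K" using K[of x] by simp
    have "cinner x x = complex_of_real s"
      unfolding x_def s_def of_real_sum
      using e by (subst cinner_sum_diagonal[where w = "\<lambda>_. 1"])
        (auto simp: orthonormal_seq_def complex_norm_square mult.commute
          simp del: of_real_power intro!: sum.cong)
    then have 2: "(norm x)\<^sup>2 = s"
      by (simp only: cinner_self of_real_eq_iff)
    have "s\<^sup>2 \<le> (norm x * K)\<^sup>2"
      using 1 s0 by (rule power_mono)
    also have "\<dots> = s * K\<^sup>2" by (simp add: power_mult_distrib 2)
    finally have "s \<le> K\<^sup>2"
      using s0 by (cases "s = 0") (auto simp: power2_eq_square)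
    then show ?thesis by (simp add: s_def)
  qed
  have "summable (\<lambda>n. (cmod (\<phi> (e n)))\<^sup>2)"
    by (rule summableI_nonneg_bounded[where x = "K\<^sup>2"]) (use bound in auto)
  from tendsto_real_sqrt[OF summable_LIMSEQ_zero[OF this]]
  show ?thesis by (simp add: tendsto_norm_zero_iff)
qed

section \<open>Unit vectors decoupled from a finite set\<close>

text \<open>
  If \<open>x\<close> is decoupled from \<open>z\<close>, then all mixed terms disappear from
  \<open>cinner (T (z + x)) (z + x)\<close>, so that \<open>x\<close> may be added without disturbing what \<open>z\<close>
  already achieves. The second condition is \<open>cinner (T v) x = 0\<close>, written so that every
  condition is linear in \<open>x\<close>.
\<close>

definition decoupled :: "('a :: complex_inner \<Rightarrow> 'a) \<Rightarrow> 'a set \<Rightarrow> 'a \<Rightarrow> bool"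
  where "decoupled T F x \<longleftrightarrow>
    (\<forall>v\<in>F. cinner x v = 0 \<and> cinner x (T v) = 0 \<and> cinner (T x) v = 0)"

lemma decoupledD:
  assumes "decoupled T F x" "v \<in> F"
  shows "cinner x v = 0" "cinner v x = 0" "cinner (T v) x = 0" "cinner (T x) v = 0"
  using assms cinner_eq_0_sym unfolding decoupled_def by blast+

lemma decoupled_sum:
  assumes "bounded_clinear T" "\<And>i. i \<in> A \<Longrightarrow> decoupled T F (a i)"
  shows "decoupled T F (\<Sum>i\<in>A. c i *\<^sub>C a i)"
  using assms
  by (auto simp: decoupled_def bounded_clinear_sum cinner_sum_left cinner_scaleC_left
      intro!: sum.neutral)

text \<open>
  The orthonormal sequences that put \<open>w\<close> into the essential numerical range have this
  property. Unlike orthonormality, it survives the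
  subtraction of a fixed vector with coefficients tending to \<open>0\<close>.
\<close>

definition weakly_null_at ::
    "('a :: complex_inner \<Rightarrow> 'a) \<Rightarrow> (nat \<Rightarrow> 'a) \<Rightarrow> complex \<Rightarrow> bool"
  where "weakly_null_at T X w \<longleftrightarrow>
    (\<forall>\<phi> :: 'a \<Rightarrow> complex. bounded_clinear \<phi> \<longrightarrow> (\<lambda>n. \<phi> (X n)) \<longlonglongrightarrow> 0) \<and>
    (\<lambda>n. norm (X n)) \<longlonglongrightarrow> 1 \<and> (\<lambda>n. cinner (T (X n)) (X n)) \<longlonglongrightarrow> w"

text \<open>
  One kernel at a time: if \<open>\<psi>\<close> does not vanish on the kernels treated so far, subtract
  \<open>\<psi> (Y n)\<close> times a fixed vector \<open>v\<close> of their intersection with \<open>\<psi> v = 1\<close>. As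
  \<open>\<psi> (Y n)\<close> tends to \<open>0\<close>, no limit changes.
\<close>

lemma weakly_null_at_in_kernels:
  fixes T :: "'a :: complex_inner \<Rightarrow> 'a" and \<Phi> :: "('a \<Rightarrow> complex) set"
  assumes T: "bounded_clinear T" and X: "weakly_null_at T X w"
    and "finite \<Phi>" "\<And>\<phi>. \<phi> \<in> \<Phi> \<Longrightarrow> bounded_clinear \<phi>"
  shows "\<exists>Y. weakly_null_at T Y w \<and> (\<forall>\<phi>\<in>\<Phi>. \<forall>n. \<phi> (Y n) = 0)"
  using assms(3,4)
proof (induction \<Phi> rule: finite_induct)
  case empty
  then show ?case using X by auto
next
  case (insert \<psi> \<Phi>)
  then obtain Y where Y: "weakly_null_at T Y w" "\<And>\<phi> n. \<phi> \<in> \<Phi> \<Longrightarrow> \<phi> (Y n) = 0"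
    by (metis insertCI)
  have \<psi>: "bounded_clinear \<psi>" and \<Phi>: "\<And>\<phi>. \<phi> \<in> \<Phi> \<Longrightarrow> bounded_clinear \<phi>"
    using insert.prems by auto
  show ?case
  proof (cases "\<forall>n. \<psi> (Y n) = 0")
    case True
    then show ?thesis using Y by auto
  next
    case False
    then obtain m where m: "\<psi> (Y m) \<noteq> 0" by blast
    define v where "v = (1 / \<psi> (Y m)) *\<^sub>C Y m"
    have v: "\<psi> v = 1" "\<And>\<phi>. \<phi> \<in> \<Phi> \<Longrightarrow> \<phi> v = 0"
      using m Y(2) \<Phi>
      by (auto simp: v_def bounded_clinear_scaleC \<psi> scaleC_complex_def)
    define c where "c n = \<psi> (Y n)" for n
    define Z where "Z n = Y n - c n *\<^sub>C v" for n
    have null: "(\<lambda>n. \<phi> (Y n)) \<longlonglongrightarrow> 0" if "bounded_clinear \<phi>" for \<phi> :: "'a \<Rightarrow> complex"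
      using Y(1) that by (auto simp: weakly_null_at_def)
    have c0: "c \<longlonglongrightarrow> 0"
      using null[OF \<psi>] by (simp add: c_def[abs_def])
    have cc0: "(\<lambda>n. cnj (c n)) \<longlonglongrightarrow> 0"
      using tendsto_cnj[OF c0] by simp
    have "(\<lambda>n. \<phi> (Z n)) \<longlonglongrightarrow> 0" if "bounded_clinear \<phi>" for \<phi> :: "'a \<Rightarrow> complex"
      using tendsto_diff[OF null[OF that] tendsto_mult_left_zero[OF c0, of "\<phi> v"]]
      by (simp add: Z_def bounded_clinear_linear[OF that] scaleC_complex_def)
    moreover have "(\<lambda>n. norm (Z n)) \<longlonglongrightarrow> 1"
    proof -
      have "(\<lambda>n. norm (Z n) - norm (Y n)) \<longlonglongrightarrow> 0"
      proof (rule Lim_null_comparison)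
        show "\<forall>\<^sub>F n in sequentially. norm (norm (Z n) - norm (Y n)) \<le> cmod (c n) * norm v"
        proof (intro always_eventually allI)
          fix n
          have "\<bar>norm (Z n) - norm (Y n)\<bar> \<le> norm (Z n - Y n)"
            by (rule norm_triangle_ineq3)
          then show "norm (norm (Z n) - norm (Y n)) \<le> cmod (c n) * norm v"
            by (simp add: Z_def)
        qed
        show "(\<lambda>n. cmod (c n) * norm v) \<longlonglongrightarrow> 0"
          using tendsto_mult_left_zero[OF tendsto_norm_zero[OF c0]] by auto
      qed
      moreover have "(\<lambda>n. norm (Y n)) \<longlonglongrightarrow> 1"
        using Y(1) by (simp add: weakly_null_at_def)
      ultimately show ?thesis
        using tendsto_add by fastforce
    qed
    moreover have "(\<lambda>n. cinner (T (Z n)) (Z n)) \<longlonglongrightarrow> w"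
    proof -
      have eq: "cinner (T (Z n)) (Z n) = cinner (T (Y n)) (Y n) - cnj (c n) * cinner (T (Y n)) v
          - c n * cnj (cinner (Y n) (T v)) + c n * cnj (c n) * cinner (T v) v" for n
        using cinner_commute[of "T v" "Y n"]
        by (simp add: Z_def bounded_clinear_linear[OF T] cinner_linear algebra_simps)
      have 1: "(\<lambda>n. cinner (T (Y n)) (Y n)) \<longlonglongrightarrow> w"
        using Y(1) by (simp add: weakly_null_at_def)
      have 2: "(\<lambda>n. cinner (T (Y n)) v) \<longlonglongrightarrow> 0"
        by (rule null[OF bounded_clinear_cinner[OF T]])
      have 3: "(\<lambda>n. cnj (cinner (Y n) (T v))) \<longlonglongrightarrow> 0"
        using tendsto_cnj[OF null[OF bounded_clinear_cinner[OF bounded_clinear_ident]]] by simp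
      have "(\<lambda>n. cinner (T (Z n)) (Z n)) \<longlonglongrightarrow> w - 0 * 0 - 0 * 0 + 0 * 0 * cinner (T v) v"
        unfolding eq by (intro tendsto_intros 1 2 3 c0 cc0)
      then show ?thesis by simp
    qed
    ultimately have "weakly_null_at T Z w"
      by (simp add: weakly_null_at_def)
    moreover have "\<phi> (Z n) = 0" if "\<phi> \<in> insert \<psi> \<Phi>" for \<phi> n
    proof -
      have "bounded_clinear \<phi>" using that \<psi> \<Phi> by blast
      then have "\<phi> (Z n) = \<phi> (Y n) - c n * \<phi> v"
        by (simp add: Z_def bounded_clinear_linear scaleC_complex_def)
      then show ?thesis
        using that v(1) v(2)[of \<phi>] Y(2)[of \<phi> n] by (auto simp: c_def)
    qed
    ultimately show ?thesis by blast
  qed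
qed

text \<open>
  Being decoupled from a finite set means lying in the kernels of finitely many bounded
  functionals, so the sequence defining \<open>w\<close> can be moved into these kernels and then
  normalised.
\<close>

lemma decoupled_unit_vector_near:
  fixes T :: "'a :: complex_inner \<Rightarrow> 'a"
  assumes T: "bounded_clinear T" and w: "w \<in> essential_numerical_range T"
    and F: "finite F" and "\<delta> > 0"
  shows "\<exists>x. norm x = 1 \<and> decoupled T F x \<and> cmod (cinner (T x) x - w) < \<delta>"
proof -
  obtain e where e: "orthonormal_seq e" "(\<lambda>n. cinner (T (e n)) (e n)) \<longlonglongrightarrow> w"
    using w by (auto simp: essential_numerical_range_def)
  have "norm (e n) = 1" for n
    using e(1) by (intro norm_unit_if_cinner) (simp add: orthonormal_seq_def)
  then have wn: "weakly_null_at T e w"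
    using e functional_orthonormal_tendsto_0 by (auto simp: weakly_null_at_def)
  define \<Phi> where "\<Phi> = (\<lambda>v x. cinner x v) ` (F \<union> T ` F) \<union> (\<lambda>v x. cinner (T x) v) ` F"
  have "\<exists>Y. weakly_null_at T Y w \<and> (\<forall>\<phi>\<in>\<Phi>. \<forall>n. \<phi> (Y n) = 0)"
    using F bounded_clinear_cinner[OF T] bounded_clinear_cinner[OF bounded_clinear_ident]
    by (intro weakly_null_at_in_kernels[OF T wn]) (auto simp: \<Phi>_def)
  then obtain Y where Y: "weakly_null_at T Y w" and ker: "\<And>\<phi> n. \<phi> \<in> \<Phi> \<Longrightarrow> \<phi> (Y n) = 0"
    by blast
  have dec: "decoupled T F (Y n)" for n
    using ker[of "\<lambda>x. cinner x v" n for v] ker[of "\<lambda>x. cinner (T x) v" n for v]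
    by (auto simp: decoupled_def \<Phi>_def)
  have n1: "(\<lambda>n. norm (Y n)) \<longlonglongrightarrow> 1" and q: "(\<lambda>n. cinner (T (Y n)) (Y n)) \<longlonglongrightarrow> w"
    using Y by (auto simp: weakly_null_at_def)
  have "(\<lambda>n. cinner (T (Y n)) (Y n) / complex_of_real ((norm (Y n))\<^sup>2)) \<longlonglongrightarrow> w / of_real (1\<^sup>2)"
    by (intro tendsto_intros q n1) auto
  then have "\<forall>\<^sub>F n in sequentially.
      dist (cinner (T (Y n)) (Y n) / complex_of_real ((norm (Y n))\<^sup>2)) w < \<delta>"
    using \<open>\<delta> > 0\<close> by (intro tendstoD) auto
  moreover have "\<forall>\<^sub>F n in sequentially. norm (Y n) > 0"
    using order_tendstoD(1)[OF n1, of 0] by simp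
  ultimately have "\<forall>\<^sub>F n in sequentially. norm (Y n) > 0 \<and>
      dist (cinner (T (Y n)) (Y n) / complex_of_real ((norm (Y n))\<^sup>2)) w < \<delta>"
    by eventually_elim auto
  then obtain n where pos: "norm (Y n) > 0"
    and near: "dist (cinner (T (Y n)) (Y n) / complex_of_real ((norm (Y n))\<^sup>2)) w < \<delta>"
    using eventually_happens'[OF sequentially_bot] by blast
  define x where "x = complex_of_real (1 / norm (Y n)) *\<^sub>C Y n"
  have "norm x = 1" using pos by (simp add: x_def norm_divide)
  moreover have "decoupled T F x"
    using decoupled_sum[OF T, of "{n}" F Y "\<lambda>_. complex_of_real (1 / norm (Y n))"] dec
    by (simp add: x_def)
  moreover have "cinner (T x) x = cinner (T (Y n)) (Y n) / complex_of_real ((norm (Y n))\<^sup>2)"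
    using pos
    by (simp add: x_def bounded_clinear_linear[OF T] cinner_linear power2_eq_square)
  ultimately show ?thesis using near by (auto simp: dist_norm)
qed

text \<open>
  Choosing each vector decoupled from its predecessors diagonalises both the inner product
  and the form of \<open>T\<close> on the family. The predicate \<open>P\<close> serves for approximate and for
  exact prescriptions of the values.
\<close>

lemma decoupled_family:
  fixes T :: "'a :: complex_inner \<Rightarrow> 'a" and k :: nat
  assumes "\<And>i F. i < k \<Longrightarrow> finite F \<Longrightarrow>
      \<exists>x. norm x = 1 \<and> decoupled T F x \<and> P i (cinner (T x) x)"
    and F: "finite F"
  shows "\<exists>a. (\<forall>i<k. decoupled T F (a i) \<and> P i (cinner (T (a i)) (a i))) \<and>
    (\<forall>i<k. \<forall>j<k. cinner (a i) (a j) = (if i = j then 1 else 0)) \<and>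
    (\<forall>i<k. \<forall>j<k. cinner (T (a i)) (a j) = (if i = j then cinner (T (a i)) (a i) else 0))"
  using assms(1)
proof (induction k)
  case 0
  then show ?case by simp
next
  case (Suc k)
  have "\<exists>a. (\<forall>i<k. decoupled T F (a i) \<and> P i (cinner (T (a i)) (a i))) \<and>
    (\<forall>i<k. \<forall>j<k. cinner (a i) (a j) = (if i = j then 1 else 0)) \<and>
    (\<forall>i<k. \<forall>j<k. cinner (T (a i)) (a j) = (if i = j then cinner (T (a i)) (a i) else 0))"
    by (rule Suc.IH) (rule Suc.prems, simp_all)
  then obtain a where a:
      "\<And>i. i < k \<Longrightarrow> decoupled T F (a i) \<and> P i (cinner (T (a i)) (a i))"
      "\<And>i j. i < k \<Longrightarrow> j < k \<Longrightarrow> cinner (a i) (a j) = (if i = j then 1 else 0)"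
      "\<And>i j. i < k \<Longrightarrow> j < k \<Longrightarrow>
        cinner (T (a i)) (a j) = (if i = j then cinner (T (a i)) (a i) else 0)"
    by blast
  obtain x where x: "norm x = 1" "decoupled T (F \<union> a ` {..<k}) x" "P k (cinner (T x) x)"
    using Suc.prems[of k "F \<union> a ` {..<k}"] F by auto
  have xF: "decoupled T F x" using x(2) by (simp add: decoupled_def)
  have xa: "cinner x (a i) = 0" "cinner (a i) x = 0" "cinner (T x) (a i) = 0"
      "cinner (T (a i)) x = 0" if "i < k" for i
    using decoupledD[OF x(2), of "a i"] that by auto
  show ?case
  proof (intro exI[of _ "a(k := x)"] conjI allI impI)
    fix i j assume ij: "i < Suc k" "j < Suc k"
    show "cinner ((a(k := x)) i) ((a(k := x)) j) = (if i = j then 1 else 0)"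
      using ij a(2)[of i j] xa[of i] xa[of j] cinner_unit[OF x(1)]
      by (cases "i = k"; cases "j = k") simp_all
    show "cinner (T ((a(k := x)) i)) ((a(k := x)) j) =
        (if i = j then cinner (T ((a(k := x)) i)) ((a(k := x)) i) else 0)"
      using ij a(3)[of i j] xa[of i] xa[of j]
      by (cases "i = k"; cases "j = k") simp_all
  next
    fix i assume i: "i < Suc k"
    show "decoupled T F ((a(k := x)) i)"
      and "P i (cinner (T ((a(k := x)) i)) ((a(k := x)) i))"
      using i a(1)[of i] xF x(3) by (cases "i = k"; simp)+
  qed
qed

lemma convex_hull_image_subset:
  fixes b :: "'i \<Rightarrow> 'b :: real_vector"
  assumes "finite A"
  shows "convex hull (b ` A) \<subseteq>
    {\<Sum>i\<in>A. c i *\<^sub>R b i | c. (\<forall>i\<in>A. 0 \<le> c i) \<and> sum c A = 1}" (is "_ \<subseteq> ?S")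
proof (rule hull_minimal)
  show "b ` A \<subseteq> ?S"
  proof safe
    fix i assume "i \<in> A"
    then show "\<exists>c. b i = (\<Sum>j\<in>A. c j *\<^sub>R b j) \<and> (\<forall>j\<in>A. 0 \<le> c j) \<and> sum c A = 1"
      using assms
      by (intro exI[of _ "\<lambda>j. if j = i then 1 else 0"])
        (auto simp: if_distrib[of "\<lambda>r. r *\<^sub>R _"] cong: if_cong)
  qed
  show "convex ?S"
  proof (rule convexI, clarsimp)
    fix c d :: "'i \<Rightarrow> real" and u v :: real
    assume "0 \<le> u" "0 \<le> v" "u + v = 1" "\<forall>i\<in>A. 0 \<le> c i" "sum c A = 1" "\<forall>i\<in>A. 0 \<le> d i"
      "sum d A = 1"
    then show "\<exists>e. u *\<^sub>R (\<Sum>i\<in>A. c i *\<^sub>R b i) + v *\<^sub>R (\<Sum>i\<in>A. d i *\<^sub>R b i) =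
        (\<Sum>i\<in>A. e i *\<^sub>R b i) \<and> (\<forall>i\<in>A. 0 \<le> e i) \<and> sum e A = 1"
      by (intro exI[of _ "\<lambda>i. u * c i + v * d i"])
        (auto simp: scaleR_sum_right sum.distrib scaleR_add_left sum_distrib_left[symmetric])
  qed
qed

text \<open>
  The four points \<open>\<delta> * \<i> ^ k\<close> surround \<open>0\<close> so robustly that moving each by at most
  \<open>\<delta> / 2\<close> cannot separate them from \<open>0\<close>: a separating direction \<open>d\<close> would satisfy
  \<open>\<bar>Re d\<bar> < cmod d / 2\<close> and \<open>\<bar>Im d\<bar> < cmod d / 2\<close>.
\<close>

lemma zero_in_hull_perturbed_square:
  fixes b :: "nat \<Rightarrow> complex"
  assumes "\<delta> > 0" and b: "\<And>i. i < 4 \<Longrightarrow> cmod (b i - \<delta> * \<i> ^ i) < \<delta> / 2"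
  shows "0 \<in> convex hull (b ` {..<4})"
proof (rule ccontr)
  assume "0 \<notin> convex hull (b ` {..<4})"
  then obtain d r where "0 < r" and sep: "\<And>x. x \<in> convex hull (b ` {..<4}) \<Longrightarrow> r < inner d x"
    using separating_hyperplane_closed_0[of "convex hull (b ` {..<4})"]
    by (auto simp: compact_imp_closed finite_imp_compact_convex_hull)
  define m where "m = (\<bar>Re d\<bar> + \<bar>Im d\<bar>) * (\<delta> / 2)"
  have pos: "0 < inner d (\<delta> * \<i> ^ i) + m" if "i < 4" for i
  proof -
    have "inner d (b i) > 0"
      using sep[of "b i"] that \<open>0 < r\<close> by (force intro: hull_inc)
    moreover have "inner d (b i) = inner d (\<delta> * \<i> ^ i) + inner d (b i - \<delta> * \<i> ^ i)"
      by (simp add: inner_diff_right)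
    moreover have "inner d (b i - \<delta> * \<i> ^ i) \<le> cmod d * cmod (b i - \<delta> * \<i> ^ i)"
      by (rule norm_cauchy_schwarz)
    moreover have "\<dots> \<le> m"
      unfolding m_def using b[OF that] cmod_le[of d] by (intro mult_mono) auto
    ultimately show ?thesis by linarith
  qed
  have "0 < Re d * \<delta> + m" "0 < Im d * \<delta> + m" "0 < - Re d * \<delta> + m" "0 < - Im d * \<delta> + m"
    using pos[of 0] pos[of 1] pos[of 2] pos[of 3]
    by (simp_all add: inner_complex_def power3_eq_cube)
  then have "\<bar>Re d * \<delta>\<bar> + \<bar>Im d * \<delta>\<bar> < 2 * m" by linarith
  then show False
    using \<open>\<delta> > 0\<close> by (simp add: m_def abs_mult algebra_simps)
qed

text \<open>
  Approximate values become exact by convexity: along pairwise decoupled unit vectors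
  \<open>a i\<close> the coefficients \<open>sqrt (c i)\<close> produce the value with convex weights \<open>c i\<close>.
  This is the easy case of convexity of the numerical range.
\<close>

lemma decoupled_unit_vector:
  fixes T :: "'a :: complex_inner \<Rightarrow> 'a"
  assumes T: "bounded_clinear T" and W: "cball w \<delta> \<subseteq> essential_numerical_range T"
    and F: "finite F" and "\<delta> > 0"
  shows "\<exists>x. norm x = 1 \<and> decoupled T F x \<and> cinner (T x) x = w"
proof -
  have "\<exists>a. (\<forall>i<4::nat. decoupled T F (a i) \<and>
        cmod (cinner (T (a i)) (a i) - (w + \<delta> * \<i> ^ i)) < \<delta> / 2) \<and>
      (\<forall>i<4. \<forall>j<4. cinner (a i) (a j) = (if i = j then 1 else 0)) \<and>
      (\<forall>i<4. \<forall>j<4. cinner (T (a i)) (a j) = (if i = j then cinner (T (a i)) (a i) else 0))"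
  proof (rule decoupled_family[OF _ F])
    fix i :: nat and G :: "'a set"
    assume "finite G"
    have "w + \<delta> * \<i> ^ i \<in> cball w \<delta>"
      using \<open>\<delta> > 0\<close> by (simp add: dist_norm norm_mult norm_power)
    then show "\<exists>x. norm x = 1 \<and> decoupled T G x \<and>
        cmod (cinner (T x) x - (w + \<delta> * \<i> ^ i)) < \<delta> / 2"
      using \<open>\<delta> > 0\<close> \<open>finite G\<close> W by (intro decoupled_unit_vector_near[OF T]) auto
  qed
  then obtain a :: "nat \<Rightarrow> 'a" where a: "\<And>i. i < 4 \<Longrightarrow> decoupled T F (a i)"
      "\<And>i. i < 4 \<Longrightarrow> cmod (cinner (T (a i)) (a i) - (w + \<delta> * \<i> ^ i)) < \<delta> / 2"
      "\<And>i j. i < 4 \<Longrightarrow> j < 4 \<Longrightarrow> cinner (a i) (a j) = (if i = j then 1 else 0)"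
      "\<And>i j. i < 4 \<Longrightarrow> j < 4 \<Longrightarrow>
        cinner (T (a i)) (a j) = (if i = j then cinner (T (a i)) (a i) else 0)"
    by blast
  define b where "b i = cinner (T (a i)) (a i) - w" for i
  have "0 \<in> convex hull (b ` {..<4})"
    using a(2) \<open>\<delta> > 0\<close> by (intro zero_in_hull_perturbed_square) (auto simp: b_def diff_diff_eq)
  then have "0 \<in> {\<Sum>i<4. c i *\<^sub>R b i | c. (\<forall>i\<in>{..<4}. 0 \<le> c i) \<and> sum c {..<4} = 1}"
    by (rule subsetD[OF convex_hull_image_subset, rotated]) simp
  then obtain c where c: "\<And>i. i < 4 \<Longrightarrow> 0 \<le> c i" "sum c {..<4} = 1"
      and c0: "0 = (\<Sum>i<4. c i *\<^sub>R b i)"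
    by blast
  define x where "x = (\<Sum>i<4. complex_of_real (sqrt (c i)) *\<^sub>C a i)"
  have sq: "complex_of_real (sqrt (c i)) * complex_of_real (sqrt (c i)) = complex_of_real (c i)"
    if "i < 4" for i
    using c(1)[OF that] by (simp flip: of_real_mult)
  have diag: "cinner (T (a i)) (a j) = (if i = j then cinner (T (a i)) (a i) else 0)"
    if "i \<in> {..<4}" "j \<in> {..<4}" for i j
    using that by (intro a(4)) simp_all
  have sum1: "(\<Sum>i<4. complex_of_real (c i)) = 1"
    using c(2) by (simp flip: of_real_sum)
  have "cinner x x = (\<Sum>i<4. complex_of_real (c i))"
    unfolding x_def
    by (subst cinner_sum_diagonal[where w = "\<lambda>_. 1"]) (auto simp: a(3) sq)
  then have "norm x = 1" by (intro norm_unit_if_cinner) (simp only: sum1)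
  moreover have "decoupled T F x"
    unfolding x_def using a(1) by (intro decoupled_sum[OF T]) auto
  moreover have "cinner (T x) x = (\<Sum>i<4. complex_of_real (c i) * cinner (T (a i)) (a i))"
    unfolding x_def bounded_clinear_sum[OF T]
    by (subst cinner_sum_diagonal[OF finite_lessThan diag]) (auto simp: sq)
  moreover have "\<dots> = (\<Sum>i<4. c i *\<^sub>R b i) + (\<Sum>i<4. complex_of_real (c i)) * w"
    unfolding sum_distrib_right sum.distrib[symmetric]
    by (intro sum.cong refl) (simp add: b_def scaleR_conv_of_real algebra_simps)
  ultimately show ?thesis
    using c0 sum1 by auto
qed

section \<open>One step of the construction\<close>

text \<open>
  Compressed to a suitable three-dimensional space, \<open>T\<close> becomes \<open>l\<close> plus \<open>r\<close> times a
  cyclic shift: take pairwise decoupled unit vectors with the values \<open>l + r * \<omega> ^ i\<close>, where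
  \<open>\<omega>\<close> is a primitive cube root of unity, and pass to the Fourier basis. In that basis
  \<open>f\<close> sees only \<open>T x\<close> and \<open>g\<close> only the adjoint of \<open>T\<close> at \<open>x\<close>, so that the two
  off-diagonal entries next to \<open>x\<close> can be prescribed independently.
\<close>

lemma cyclic_triple:
  fixes T :: "'a :: complex_inner \<Rightarrow> 'a"
  assumes T: "bounded_clinear T" and W: "cball l (r + \<delta>) \<subseteq> essential_numerical_range T"
    and F: "finite F" and "r \<ge> 0" "\<delta> > 0"
  shows "\<exists>x f g. decoupled T F x \<and> decoupled T F f \<and> decoupled T F g \<and>
    norm x = 1 \<and> norm f = 1 \<and> norm g = 1 \<and> cinner x f = 0 \<and> cinner x g = 0 \<and> cinner f g = 0 \<and>
    cinner (T x) x = l \<and> cinner (T x) f = r \<and> cinner (T x) g = 0 \<and>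
    cinner (T f) x = 0 \<and> cinner (T g) x = r"
proof -
  define \<omega> where "\<omega> = Complex (-1/2) (sqrt 3 / 2)"
  have cnj: "cnj \<omega> = - 1 - \<omega>" and sq: "\<omega> * \<omega> = - 1 - \<omega>"
    by (simp_all add: \<omega>_def complex_eq_iff)
  have sq': "\<omega> * (\<omega> * c) = - c - \<omega> * c" for c
    by (simp add: mult.assoc[symmetric] sq algebra_simps)
  have "(cmod \<omega>)\<^sup>2 = 1"
    by (simp add: \<omega>_def cmod_power2 power_divide)
  then have norm1: "cmod \<omega> = 1"
    using norm_ge_zero[of \<omega>] by (simp add: power2_eq_1_iff)
  have "\<exists>a. (\<forall>i<3::nat. decoupled T F (a i) \<and> cinner (T (a i)) (a i) = l + r * \<omega> ^ i) \<and>
      (\<forall>i<3. \<forall>j<3. cinner (a i) (a j) = (if i = j then 1 else 0)) \<and>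
      (\<forall>i<3. \<forall>j<3. cinner (T (a i)) (a j) = (if i = j then cinner (T (a i)) (a i) else 0))"
  proof (rule decoupled_family[OF _ F])
    fix i :: nat and G :: "'a set"
    assume "finite G"
    have "cball (l + r * \<omega> ^ i) \<delta> \<subseteq> cball l (r + \<delta>)"
      using \<open>r \<ge> 0\<close>
      by (subst cball_subset_cball_iff) (simp add: dist_norm norm_mult norm_power norm1)
    then show "\<exists>x. norm x = 1 \<and> decoupled T G x \<and> cinner (T x) x = l + r * \<omega> ^ i"
      using W \<open>\<delta> > 0\<close> \<open>finite G\<close> by (intro decoupled_unit_vector[OF T]) auto
  qed
  then obtain a :: "nat \<Rightarrow> 'a" where a: "\<And>i. i < 3 \<Longrightarrow> decoupled T F (a i)"
      "\<And>i. i < 3 \<Longrightarrow> cinner (T (a i)) (a i) = l + r * \<omega> ^ i"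
      "\<And>i j. i < 3 \<Longrightarrow> j < 3 \<Longrightarrow> cinner (a i) (a j) = (if i = j then 1 else 0)"
      "\<And>i j. i < 3 \<Longrightarrow> j < 3 \<Longrightarrow>
        cinner (T (a i)) (a j) = (if i = j then cinner (T (a i)) (a i) else 0)"
    by blast
  define k where "k = complex_of_real (1 / sqrt 3)"
  have k: "k * cnj k = 1 / 3"
    by (simp add: k_def of_real_mult[symmetric] del: of_real_mult)
  define e where "e p q = (\<Sum>i<3::nat. (k * (if i = 0 then 1 else if i = 1 then p else q)) *\<^sub>C a i)"
    for p q
  have e: "cinner (e p q) (e p' q') = (1 + p * cnj p' + q * cnj q') / 3" for p q p' q'
  proof -
    have "cinner (e p q) (e p' q') = k * cnj k * (1 + p * cnj p' + q * cnj q')"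
      unfolding e_def
      by (subst cinner_sum_diagonal[where w = "\<lambda>_. 1"])
        (auto simp: a(3) numeral_3_eq_3 algebra_simps)
    then show ?thesis by (simp add: k)
  qed
  have diag: "cinner (T (a i)) (a j) = (if i = j then cinner (T (a i)) (a i) else 0)"
    if "i \<in> {..<3}" "j \<in> {..<3}" for i j
    using that by (intro a(4)) simp_all
  have Te: "cinner (T (e p q)) (e p' q') =
      (l + r + p * cnj p' * (l + r * \<omega>) + q * cnj q' * (l + r * (\<omega> * \<omega>))) / 3" for p q p' q'
  proof -
    have "cinner (T (e p q)) (e p' q') = k * cnj k *
        (l + r + p * cnj p' * (l + r * \<omega>) + q * cnj q' * (l + r * (\<omega> * \<omega>)))"
      unfolding e_def bounded_clinear_sum[OF T]
      by (subst cinner_sum_diagonal[OF finite_lessThan diag])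
        (auto simp: a(2) numeral_3_eq_3 algebra_simps)
    then show ?thesis by (simp add: k)
  qed
  have dec: "decoupled T F (e p q)" for p q
    unfolding e_def by (intro decoupled_sum[OF T]) (simp add: a(1))
  define x where "x = e 1 1"
  define f where "f = e \<omega> (cnj \<omega>)"
  define g where "g = e (cnj \<omega>) \<omega>"
  have "norm x = 1" "norm f = 1" "norm g = 1"
    by (auto intro!: norm_unit_if_cinner simp: x_def f_def g_def e cnj sq algebra_simps)
  moreover have "cinner x f = 0" "cinner x g = 0" "cinner f g = 0"
    by (auto simp: x_def f_def g_def e cnj sq algebra_simps)
  moreover have "cinner (T x) x = l" "cinner (T x) f = r" "cinner (T x) g = 0"
      "cinner (T f) x = 0" "cinner (T g) x = r"
    by (auto simp: x_def f_def g_def Te cnj sq sq' algebra_simps)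
  moreover have "decoupled T F x" "decoupled T F f" "decoupled T F g"
    by (simp_all add: x_def f_def g_def dec)
  ultimately show ?thesis
    by (intro exI[of _ x] exI[of _ f] exI[of _ g] conjI)
qed

text \<open>
  The vectors of \<open>F\<close> are those chosen so far, \<open>u\<close> is the latest of them and \<open>y\<close> is the
  vector to be approximated next. Adding \<open>f\<close> and \<open>g\<close> with suitable coefficients to the
  next basis vector steers its two matrix entries with \<open>u\<close>, and this costs nothing in the
  approximation of \<open>y\<close>.
\<close>

definition steerable :: "('a :: complex_inner \<Rightarrow> 'a) \<Rightarrow> 'a set \<Rightarrow> 'a \<Rightarrow> 'a \<Rightarrow> 'a \<Rightarrow> 'a \<Rightarrow> real \<Rightarrow> bool"
  where "steerable T F y u f g \<rho> \<longleftrightarrow>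
    finite F \<and> (\<forall>v\<in>F. \<forall>w\<in>F. cinner v w = (if v = w then 1 else 0)) \<and> u \<in> F \<and>
    norm f = 1 \<and> norm g = 1 \<and> cinner f g = 0 \<and>
    (\<forall>v\<in>insert y F. cinner f v = 0 \<and> cinner g v = 0) \<and>
    cinner (T u) f = \<rho> \<and> cinner (T u) g = 0 \<and> cinner (T f) u = 0 \<and> cinner (T g) u = \<rho>"

lemma norm_add_orthogonal:
  fixes x y :: "'a :: complex_inner"
  assumes "cinner x y = 0"
  shows "(norm (x + y))\<^sup>2 = (norm x)\<^sup>2 + (norm y)\<^sup>2"
proof -
  have "cinner y x = 0" using assms by (rule cinner_eq_0_sym)
  then have "cinner (x + y) (x + y) = cinner x x + cinner y y"
    using assms by (simp add: cinner_linear)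
  then show ?thesis by (simp only: cinner_self of_real_add[symmetric] of_real_eq_iff)
qed

lemma orthonormal_residual:
  fixes y :: "'a :: complex_inner"
  assumes "finite F" "\<And>v w. v \<in> F \<Longrightarrow> w \<in> F \<Longrightarrow> cinner v w = (if v = w then 1 else 0)"
  shows "\<exists>R. y - R \<in> cspan F \<and> (\<forall>v\<in>F. cinner R v = 0)"
proof -
  define P where "P = (\<Sum>v\<in>F. cinner y v *\<^sub>C v)"
  have "cinner P w = cinner y w" if "w \<in> F" for w
  proof -
    have "cinner P w = (\<Sum>v\<in>F. cinner y v * (if v = w then 1 else 0))"
      unfolding P_def cinner_sum_left
      by (intro sum.cong refl) (simp add: cinner_linear assms(2) that)
    then show ?thesis using assms(1) that by (simp add: if_distrib cong: if_cong)
  qed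
  moreover have "P \<in> cspan F"
    unfolding P_def
    by (intro complex_vector.span_sum complex_vector.span_scale complex_vector.span_base)
  ultimately show ?thesis
    by (intro exI[of _ "y - P"]) (auto simp: cinner_linear)
qed

lemma cinner_span_0:
  assumes "\<And>v. v \<in> F \<Longrightarrow> cinner v d = 0" "x \<in> cspan F"
  shows "cinner x d = 0"
  using assms(2)
proof (induction rule: complex_vector.span_induct_alt)
  case base
  then show ?case by simp
next
  case (step c x y)
  then show ?case by (simp add: cinner_linear assms(1))
qed

text \<open>
  The part \<open>z\<close> of the next basis vector that points to the residual of \<open>y\<close> and steers
  the entries with \<open>u\<close>. Every numerical margin of the construction is spent here: the
  length \<open>s\<close> of the step towards \<open>y\<close> and the prescribed entries are at most
  \<open>\<epsilon> * sqrt \<epsilon> / 16\<close>, the leverage \<open>\<rho>\<close> is at least \<open>sqrt (7 / 8) * \<epsilon>\<close>, whence \<open>(norm z)\<^sup>2\<close> is at most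
  a small multiple of \<open>\<epsilon>\<close>.
\<close>

lemma steering_vector:
  fixes T :: "'a :: complex_inner \<Rightarrow> 'a"
  assumes T: "bounded_clinear T" and T1: "\<And>x. norm (T x) \<le> norm x"
    and \<epsilon>: "0 < \<epsilon>" "\<epsilon> \<le> 1 / 2"
    and \<mu>: "cmod \<mu> \<le> \<epsilon> * sqrt \<epsilon> / 16" and \<nu>: "cmod \<nu> \<le> \<epsilon> * sqrt \<epsilon> / 16"
    and steer: "steerable T F y u f g \<rho>" and \<rho>: "0 < \<rho>" "7 / 8 * \<epsilon>\<^sup>2 \<le> \<rho>\<^sup>2"
  shows "\<exists>z. (norm z)\<^sup>2 \<le> \<epsilon> / 4 \<and> (\<forall>v\<in>F. cinner z v = 0) \<and>
    cinner (T u) z = \<mu> \<and> cinner (T z) u = \<nu> \<and>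
    (\<exists>v\<in>cspan F. \<epsilon> * sqrt \<epsilon> / 16 * norm (y - v) \<le> cmod (cinner y z))"
proof -
  have F: "finite F" "\<And>v w. v \<in> F \<Longrightarrow> w \<in> F \<Longrightarrow> cinner v w = (if v = w then 1 else 0)"
    and u: "u \<in> F" and fg: "norm f = 1" "norm g = 1" "cinner f g = 0"
    and fF: "\<And>v. v \<in> F \<Longrightarrow> cinner f v = 0" "cinner f y = 0"
    and gF: "\<And>v. v \<in> F \<Longrightarrow> cinner g v = 0" "cinner g y = 0"
    and uf: "cinner (T u) f = \<rho>" "cinner (T u) g = 0" "cinner (T f) u = 0" "cinner (T g) u = \<rho>"
    using steer by (auto simp: steerable_def)
  have "norm u = 1" using F(2) u by (intro norm_unit_if_cinner) simp
  define s where "s = \<epsilon> * sqrt \<epsilon> / 16"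
  have s0: "0 \<le> s" and s2: "s\<^sup>2 = \<epsilon> ^ 3 / 256"
    using \<epsilon> by (simp_all add: s_def power_mult_distrib power_divide power3_eq_cube power2_eq_square)
  obtain R where R: "y - R \<in> cspan F" "\<And>v. v \<in> F \<Longrightarrow> cinner R v = 0"
    using orthonormal_residual[OF F] by blast
  define d where "d = complex_of_real (1 / norm R) *\<^sub>C R"
  have dF: "cinner d v = 0" "cinner v d = 0" if "v \<in> F" for v
    using R(2)[OF that] cinner_eq_0_sym[OF R(2)[OF that]] by (simp_all add: d_def cinner_linear)
  have yR: "cinner y v = cinner R v" if "\<And>w. w \<in> F \<Longrightarrow> cinner v w = 0" for v
  proof -
    have "cinner (y - R) v = 0"
      using R(1) by (rule cinner_span_0[rotated]) (rule cinner_eq_0_sym[OF that])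
    then show ?thesis by (simp add: cinner_diff_left)
  qed
  have yfg: "cinner y f = 0" "cinner y g = 0"
    by (rule cinner_eq_0_sym[OF fF(2)], rule cinner_eq_0_sym[OF gF(2)])
  then have "cinner R f = 0" "cinner R g = 0"
    using yR[of f] yR[of g] fF(1) gF(1) by simp_all
  then have df: "cinner d f = 0" "cinner d g = 0"
    by (simp_all add: d_def cinner_linear)
  \<comment> \<open>If \<open>y\<close> already lies in the span, then \<open>d = 0\<close> by the convention \<open>1 / 0 = 0\<close>.\<close>
  have d1: "norm d \<le> 1" by (simp add: d_def norm_divide)
  have yd: "cinner y d = complex_of_real (norm R)"
  proof -
    have "cinner y d = cinner R d"
      using yR[of d] dF(1) by simp
    then show ?thesis
      by (cases "R = 0") (auto simp: d_def cinner_linear cinner_self power2_eq_square)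
  qed
  define z0 where "z0 = complex_of_real s *\<^sub>C d"
  have z0: "norm z0 \<le> s"
    using d1 s0 by (simp add: z0_def mult_left_le)
  define \<alpha> where "\<alpha> = \<mu> - cinner (T u) z0"
  define \<beta> where "\<beta> = \<nu> - cinner (T z0) u"
  have "cmod (cinner (T u) z0) \<le> s"
    using norm_cinner_le[of "T u" z0] mult_mono[OF T1[of u] z0] \<open>norm u = 1\<close> by simp
  then have \<alpha>: "cmod \<alpha> \<le> 2 * s"
    using norm_triangle_ineq4[of \<mu> "cinner (T u) z0"] \<mu> by (simp add: \<alpha>_def s_def)
  have "cmod (cinner (T z0) u) \<le> s"
    using norm_cinner_le[of "T z0" u] T1[of z0] z0 \<open>norm u = 1\<close> by simp
  then have \<beta>: "cmod \<beta> \<le> 2 * s"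
    using norm_triangle_ineq4[of \<nu> "cinner (T z0) u"] \<nu> by (simp add: \<beta>_def s_def)
  define p where "p = cnj (\<alpha> / \<rho>) *\<^sub>C f + (\<beta> / \<rho>) *\<^sub>C g"
  have p2: "(norm p)\<^sup>2 = ((cmod \<alpha>)\<^sup>2 + (cmod \<beta>)\<^sup>2) / \<rho>\<^sup>2"
  proof -
    have "(norm p)\<^sup>2 = (norm (cnj (\<alpha> / \<rho>) *\<^sub>C f))\<^sup>2 + (norm ((\<beta> / \<rho>) *\<^sub>C g))\<^sup>2"
      unfolding p_def by (rule norm_add_orthogonal) (simp add: cinner_linear fg)
    then show ?thesis
      by (simp add: fg norm_divide power_divide add_divide_distrib)
  qed
  define z where "z = z0 + p"
  have "(norm z)\<^sup>2 = (norm z0)\<^sup>2 + (norm p)\<^sup>2"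
    unfolding z_def
    by (intro norm_add_orthogonal) (simp add: z0_def p_def cinner_linear df)
  moreover have "(norm z0)\<^sup>2 \<le> \<epsilon> / 16"
  proof -
    have "\<epsilon> ^ 3 \<le> \<epsilon> ^ 1" using \<epsilon> by (intro power_decreasing) auto
    then show ?thesis using power_mono[OF z0, of 2] s2 \<epsilon> by simp
  qed
  moreover have "(norm p)\<^sup>2 \<le> \<epsilon> / 16"
  proof -
    have "(cmod \<alpha>)\<^sup>2 + (cmod \<beta>)\<^sup>2 \<le> 8 * s\<^sup>2"
      using power_mono[OF \<alpha>, of 2] power_mono[OF \<beta>, of 2] by (simp add: power_mult_distrib)
    also have "\<dots> \<le> \<epsilon> / 16 * (7 / 8 * \<epsilon>\<^sup>2)"
      unfolding s2 using \<epsilon> by (simp add: power3_eq_cube power2_eq_square)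
    also have "\<dots> \<le> \<epsilon> / 16 * \<rho>\<^sup>2"
      using \<rho>(2) \<epsilon> by (intro mult_left_mono) auto
    finally show ?thesis
      using \<rho>(1) by (simp add: p2 pos_divide_le_eq)
  qed
  ultimately have "(norm z)\<^sup>2 \<le> \<epsilon> / 4" using \<epsilon> by linarith
  moreover have "cinner z v = 0" if "v \<in> F" for v
    using that dF fF gF by (simp add: z_def z0_def p_def cinner_linear)
  moreover have "cinner (T u) z = \<mu>"
    using \<rho>(1) by (simp add: z_def cinner_add_right[of _ z0 p])
      (simp add: p_def cinner_linear uf \<alpha>_def)
  moreover have "cinner (T z) u = \<nu>"
    using \<rho>(1) by (simp add: z_def bounded_clinear_add[OF T, of z0 p] cinner_add_left)
      (simp add: p_def cinner_linear bounded_clinear_linear[OF T] uf \<beta>_def)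
  moreover have "cinner y z = complex_of_real (s * norm R)"
    by (simp add: z_def z0_def p_def cinner_linear yd yfg)
  then have "cmod (cinner y z) = s * norm R"
    using s0 by (simp add: norm_mult)
  then have "\<epsilon> * sqrt \<epsilon> / 16 * norm (y - (y - R)) \<le> cmod (cinner y z)"
    by (simp add: s_def)
  ultimately show ?thesis using R(1) by blast
qed

text \<open>
  The next basis vector is \<open>z + t x\<close>, where \<open>x\<close> is decoupled from everything before and
  carries most of the norm. As \<open>z\<close> is short, the value that \<open>x\<close> must have to make the
  diagonal entry equal to \<open>l\<close> lies within \<open>4 / 7 * \<epsilon>\<close> of \<open>l\<close>, which leaves room in
  \<open>cball l (2 * \<epsilon>)\<close> for a cyclic triple of radius \<open>\<epsilon>\<close> around it.
\<close>

lemma extension_step: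
  fixes T :: "'a :: complex_inner \<Rightarrow> 'a"
  assumes T: "bounded_clinear T" and T1: "\<And>x. norm (T x) \<le> norm x"
    and \<epsilon>: "0 < \<epsilon>" "\<epsilon> \<le> 1 / 2"
    and W: "cball l (2 * \<epsilon>) \<subseteq> essential_numerical_range T" and l: "cmod l \<le> 1"
    and \<mu>: "cmod \<mu> \<le> \<epsilon> * sqrt \<epsilon> / 16" and \<nu>: "cmod \<nu> \<le> \<epsilon> * sqrt \<epsilon> / 16"
    and steer: "steerable T F y u f g \<rho>" and \<rho>: "0 < \<rho>" "7 / 8 * \<epsilon>\<^sup>2 \<le> \<rho>\<^sup>2"
  shows "\<exists>u' f' g' \<rho>'. steerable T (insert u' F) y' u' f' g' \<rho>' \<and> 0 < \<rho>' \<and> 7 / 8 * \<epsilon>\<^sup>2 \<le> \<rho>'\<^sup>2 \<and>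
    cinner (T u') u' = l \<and> (\<forall>v\<in>F. cinner v u' = 0) \<and>
    cinner (T u) u' = \<mu> \<and> cinner (T u') u = \<nu> \<and>
    (\<exists>v\<in>cspan F. \<epsilon> * sqrt \<epsilon> / 16 * norm (y - v) \<le> cmod (cinner y u'))"
proof -
  obtain z where z: "(norm z)\<^sup>2 \<le> \<epsilon> / 4" "\<And>v. v \<in> F \<Longrightarrow> cinner z v = 0"
      "cinner (T u) z = \<mu>" "cinner (T z) u = \<nu>"
      "\<exists>v\<in>cspan F. \<epsilon> * sqrt \<epsilon> / 16 * norm (y - v) \<le> cmod (cinner y z)"
    using steering_vector[OF T T1 \<epsilon> \<mu> \<nu> steer \<rho>] by blast
  have F: "finite F" "\<And>v w. v \<in> F \<Longrightarrow> w \<in> F \<Longrightarrow> cinner v w = (if v = w then 1 else 0)"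
    and u: "u \<in> F"
    using steer by (auto simp: steerable_def)
  define t where "t = sqrt (1 - (norm z)\<^sup>2)"
  have t2: "t\<^sup>2 = 1 - (norm z)\<^sup>2" and t78: "7 / 8 \<le> t\<^sup>2" and t0: "0 < t"
    using z(1) \<epsilon> by (auto simp: t_def)
  define m where "m = (l - cinner (T z) z) / complex_of_real (t\<^sup>2)"
  have "cmod (m - l) \<le> 4 / 7 * \<epsilon>"
  proof -
    have "m - l = (complex_of_real ((norm z)\<^sup>2) * l - cinner (T z) z) / complex_of_real (t\<^sup>2)"
    proof -
      have "complex_of_real (t\<^sup>2) \<noteq> 0" using t0 by simp
      then have "m - l = (l - cinner (T z) z - complex_of_real (t\<^sup>2) * l) / complex_of_real (t\<^sup>2)"
        by (simp add: m_def diff_divide_distrib)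
      then show ?thesis by (simp add: t2 algebra_simps)
    qed
    then have "cmod (m - l) = cmod (complex_of_real ((norm z)\<^sup>2) * l - cinner (T z) z) / t\<^sup>2"
      by (simp add: norm_divide norm_power del: of_real_power)
    also have "\<dots> \<le> (\<epsilon> / 2) / (7 / 8)"
    proof (rule frac_le)
      have "cmod (complex_of_real ((norm z)\<^sup>2) * l) \<le> (norm z)\<^sup>2"
        using l by (simp add: norm_mult norm_power mult_left_le)
      moreover have "cmod (cinner (T z) z) \<le> (norm z)\<^sup>2"
        using norm_cinner_le[of "T z" z] mult_right_mono[OF T1[of z], of "norm z"]
        by (simp add: power2_eq_square)
      ultimately show "cmod (complex_of_real ((norm z)\<^sup>2) * l - cinner (T z) z) \<le> \<epsilon> / 2"
        using norm_triangle_ineq4[of "complex_of_real ((norm z)\<^sup>2) * l" "cinner (T z) z"] z(1)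
        by linarith
    qed (use t78 \<epsilon> in auto)
    finally show ?thesis by simp
  qed
  then have "cball m (\<epsilon> + \<epsilon> / 4) \<subseteq> cball l (2 * \<epsilon>)"
    using \<epsilon> by (subst cball_subset_cball_iff) (simp add: dist_norm)
  then have "cball m (\<epsilon> + \<epsilon> / 4) \<subseteq> essential_numerical_range T"
    using W by blast
  then obtain x f' g' where
      dec: "decoupled T (F \<union> {z, y, y'}) x" "decoupled T (F \<union> {z, y, y'}) f'"
        "decoupled T (F \<union> {z, y, y'}) g'"
    and orth: "norm x = 1" "norm f' = 1" "norm g' = 1" "cinner x f' = 0" "cinner x g' = 0"
        "cinner f' g' = 0"
    and val: "cinner (T x) x = m" "cinner (T x) f' = \<epsilon>" "cinner (T x) g' = 0"
        "cinner (T f') x = 0" "cinner (T g') x = \<epsilon>"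
    using cyclic_triple[OF T, of m \<epsilon> "\<epsilon> / 4" "F \<union> {z, y, y'}"] F(1) \<epsilon> by auto
  note x0 = decoupledD[OF dec(1)] and f0 = decoupledD[OF dec(2)] and g0 = decoupledD[OF dec(3)]
  have orth': "cinner f' x = 0" "cinner g' x = 0"
    by (rule cinner_eq_0_sym[OF orth(4)], rule cinner_eq_0_sym[OF orth(5)])
  define u' where "u' = z + complex_of_real t *\<^sub>C x"
  have tt: "complex_of_real t * complex_of_real t = complex_of_real (t\<^sup>2)"
    by (simp add: power2_eq_square)
  have Fu': "cinner u' v = 0" "cinner v u' = 0" if "v \<in> F" for v
  proof -
    show "cinner u' v = 0"
      using that z(2) x0 by (simp add: u'_def cinner_linear)
    then show "cinner v u' = 0" by (rule cinner_eq_0_sym)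
  qed
  have "cinner u' u' = cinner z z + complex_of_real t * complex_of_real t * cinner x x"
    using x0[of z] by (simp add: u'_def cinner_linear)
  also have "\<dots> = 1"
    by (simp only: tt t2 cinner_unit[OF orth(1)]) (simp add: cinner_self)
  finally have u'1: "cinner u' u' = 1" .
  have "cinner (T u') u' = cinner (T z) z + complex_of_real t * complex_of_real t * cinner (T x) x"
    using x0[of z] by (simp add: u'_def bounded_clinear_linear[OF T] cinner_linear)
  also have "\<dots> = l"
    unfolding tt val m_def using t0 by simp
  finally have u'l: "cinner (T u') u' = l" .
  have "cinner (T u) u' = \<mu>" "cinner (T u') u = \<nu>"
    using z(3,4) x0[of u] u
    by (simp_all add: u'_def bounded_clinear_linear[OF T] cinner_linear)
  moreover have "cinner y u' = cinner y z"
    using x0[of y] by (simp add: u'_def cinner_linear)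
  moreover have "steerable T (insert u' F) y' u' f' g' (t * \<epsilon>)"
  proof -
    have "cinner f' u' = 0" "cinner g' u' = 0" "cinner (T u') f' = t * \<epsilon>" "cinner (T u') g' = 0"
        "cinner (T f') u' = 0" "cinner (T g') u' = t * \<epsilon>"
      using f0[of z] g0[of z] orth'
      by (simp_all add: u'_def bounded_clinear_linear[OF T] cinner_linear val)
    moreover have "\<forall>v\<in>insert u' F. \<forall>w\<in>insert u' F. cinner v w = (if v = w then 1 else 0)"
      using F(2) Fu' u'1 by fastforce
    moreover have "\<forall>v\<in>insert y' F. cinner f' v = 0 \<and> cinner g' v = 0"
      using f0(1) g0(1) by blast
    ultimately show ?thesis
      unfolding steerable_def using F(1) orth(2,3,6) by simp
  qed
  moreover have "7 / 8 * \<epsilon>\<^sup>2 \<le> (t * \<epsilon>)\<^sup>2"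
    using mult_right_mono[OF t78, of "\<epsilon>\<^sup>2"] by (simp add: power_mult_distrib)
  ultimately show ?thesis
    using z(5) u'l Fu' t0 \<epsilon> by (intro exI[of _ u'] exI[of _ f'] exI[of _ g'] exI[of _ "t * \<epsilon>"]) auto
qed

section \<open>The basis\<close>

lemma cball_subset_if_infdist_frontier:
  fixes x :: "'a :: real_normed_vector"
  assumes "x \<in> interior S" "r < infdist x (frontier S)" "0 \<le> r"
  shows "cball x r \<subseteq> S"
proof (rule ccontr)
  assume "\<not> cball x r \<subseteq> S"
  moreover have "x \<in> cball x r \<inter> S"
    using assms(1,3) interior_subset[of S] by auto
  ultimately have "cball x r \<inter> frontier S \<noteq> {}"
    by (intro connected_Int_frontier connected_cball) blast+
  then obtain b where "b \<in> frontier S" "dist x b \<le> r" by auto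
  then show False
    using infdist_le[of b "frontier S" x] assms(2) by linarith
qed

lemma essential_numerical_range_norm_le:
  assumes T1: "\<And>x. norm (T x) \<le> norm x" and "w \<in> essential_numerical_range T"
  shows "cmod w \<le> 1"
proof -
  obtain e where e: "orthonormal_seq e" "(\<lambda>n. cinner (T (e n)) (e n)) \<longlonglongrightarrow> w"
    using assms(2) by (auto simp: essential_numerical_range_def)
  have "cmod (cinner (T (e n)) (e n)) \<le> 1" for n
  proof -
    have "norm (e n) = 1"
      using e(1) by (intro norm_unit_if_cinner) (simp add: orthonormal_seq_def)
    then show ?thesis
      using norm_cinner_le[of "T (e n)" "e n"] T1[of "e n"] by simp
  qed
  then show ?thesis
    using tendsto_norm[OF e(2)] by (intro LIMSEQ_le_const2) auto
qed

lemma ex_sequence_infinitely_often: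
  assumes "countable D" "D \<noteq> {}"
  shows "\<exists>Y :: nat \<Rightarrow> 'a. \<forall>y\<in>D. \<forall>N. \<exists>n\<ge>N. Y (Suc n) = y"
proof (intro exI[of _ "\<lambda>n. from_nat_into D (fst (prod_decode n))"] ballI allI)
  fix y N assume "y \<in> D"
  then obtain i where "from_nat_into D i = y"
    using assms by (metis from_nat_into_surj)
  moreover have "Suc N \<le> prod_encode (i, Suc N)"
    by (rule le_prod_encode_2)
  ultimately show "\<exists>n\<ge>N. from_nat_into D (fst (prod_decode (Suc n))) = y"
    by (intro exI[of _ "prod_encode (i, Suc N) - 1"]) auto
qed

text \<open>
  By Bessel's inequality \<open>cinner y (u n)\<close> tends to \<open>0\<close>, so an orthonormal sequence that
  picks up a fixed proportion of the residual of \<open>y\<close> infinitely often forces that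
  residual to become arbitrarily small.
\<close>

lemma orthonormal_basis_if_captures:
  fixes u :: "nat \<Rightarrow> 'a :: complex_inner"
  assumes u: "orthonormal_seq u" and D: "closure D = UNIV" and "0 < s"
    and capture: "\<And>y N. y \<in> D \<Longrightarrow>
      \<exists>n\<ge>N. \<exists>v\<in>cspan (range u). s * norm (y - v) \<le> cmod (cinner y (u n))"
  shows "orthonormal_basis_seq u"
proof -
  have "y \<in> closure (cspan (range u))" if "y \<in> D" for y
    unfolding closure_approachable
  proof (intro allI impI)
    fix \<eta> :: real assume "0 < \<eta>"
    have "(\<lambda>n. cinner (u n) y) \<longlonglongrightarrow> 0"
      by (rule functional_orthonormal_tendsto_0[OF bounded_clinear_cinner[OF bounded_clinear_ident] u])
    then have "\<forall>\<^sub>F n in sequentially. dist (cinner (u n) y) 0 < s * \<eta>"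
      using \<open>0 < s\<close> \<open>0 < \<eta>\<close> by (intro tendstoD) auto
    then obtain N where N: "\<And>n. n \<ge> N \<Longrightarrow> cmod (cinner (u n) y) < s * \<eta>"
      by (auto simp: eventually_sequentially)
    obtain n v where "n \<ge> N" and v: "v \<in> cspan (range u)"
        and "s * norm (y - v) \<le> cmod (cinner y (u n))"
      using capture[OF \<open>y \<in> D\<close>] by blast
    moreover have "cmod (cinner y (u n)) = cmod (cinner (u n) y)"
      by (subst cinner_commute) simp
    ultimately have "s * norm (y - v) < s * \<eta>" using N[of n] by linarith
    then show "\<exists>v\<in>cspan (range u). dist v y < \<eta>"
      using v \<open>0 < s\<close> by (auto simp: dist_norm norm_minus_commute)
  qed
  then have "closure D \<subseteq> closure (cspan (range u))"
    by (intro closure_minimal) auto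
  then show ?thesis using u D by (auto simp: orthonormal_basis_seq_def)
qed

theorem theorem2p4:
  fixes T :: "'a :: chilbert_space \<Rightarrow> 'a"
    and \<epsilon> :: real
    and l \<mu> \<nu> :: "nat \<Rightarrow> complex"
  assumes "separable_space (euclidean :: 'a topology)"
    and "\<nexists>B :: 'a set. finite B \<and> cspan B = UNIV"
    and "bounded_clinear T"
    and "onorm T \<le> 1"
    and "\<epsilon> > 0"
    and "\<And>n. l n \<in> interior (essential_numerical_range T)"
    and "\<And>n. infdist (l n) (frontier (essential_numerical_range T)) > 2 * \<epsilon>"
    and "(SUP n. ereal (max (cmod (\<mu> n)) (cmod (\<nu> n)))) < ereal (\<epsilon> * sqrt \<epsilon> / 16)"
  shows "\<exists>u. orthonormal_basis_seq u \<and>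
    (\<forall>n. cinner (T (u n)) (u n) = l n \<and>
         cinner (T (u n)) (u (Suc n)) = \<mu> n \<and>
         cinner (T (u (Suc n))) (u n) = \<nu> n)"
proof -
  note T = assms(3)
  have T1: "norm (T x) \<le> norm x" for x
  proof -
    have "norm (T x) \<le> onorm T * norm x"
      using T by (intro onorm) (simp add: bounded_clinear_def)
    also have "\<dots> \<le> 1 * norm x"
      using assms(4) by (intro mult_right_mono) auto
    finally show ?thesis by simp
  qed
  have W: "cball (l n) (2 * \<epsilon>) \<subseteq> essential_numerical_range T" for n
    using assms(5-7) by (intro cball_subset_if_infdist_frontier) auto
  have unit: "cmod w \<le> 1" if "w \<in> cball (l n) (2 * \<epsilon>)" for w n
    using essential_numerical_range_norm_le[OF T1] W that by blast
  have l: "cmod (l n) \<le> 1" for n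
    using unit[of "l n" n] assms(5) by simp
  \<comment> \<open>A disc of radius \<open>2 * \<epsilon>\<close> fits into the closed unit disc.\<close>
  have \<epsilon>: "\<epsilon> \<le> 1 / 2"
  proof -
    have "cmod (l 0 + 2 * \<epsilon>) \<le> 1" "cmod (l 0 - 2 * \<epsilon>) \<le> 1"
      using assms(5) by (auto intro!: unit[of _ 0] simp: dist_norm norm_mult)
    then have "cmod ((l 0 + 2 * \<epsilon>) - (l 0 - 2 * \<epsilon>)) \<le> 2"
      using norm_triangle_ineq4[of "l 0 + 2 * \<epsilon>" "l 0 - 2 * \<epsilon>"] by linarith
    then show ?thesis using assms(5) by (simp add: norm_mult)
  qed
  have small: "cmod (\<mu> n) \<le> \<epsilon> * sqrt \<epsilon> / 16" "cmod (\<nu> n) \<le> \<epsilon> * sqrt \<epsilon> / 16" for n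
  proof -
    have "ereal (max (cmod (\<mu> n)) (cmod (\<nu> n))) \<le> (SUP n. ereal (max (cmod (\<mu> n)) (cmod (\<nu> n))))"
      by (rule SUP_upper) simp
    then have "ereal (max (cmod (\<mu> n)) (cmod (\<nu> n))) < ereal (\<epsilon> * sqrt \<epsilon> / 16)"
      using assms(8) by (rule le_less_trans)
    then show "cmod (\<mu> n) \<le> \<epsilon> * sqrt \<epsilon> / 16" "cmod (\<nu> n) \<le> \<epsilon> * sqrt \<epsilon> / 16" by auto
  qed
  obtain D :: "'a set" where D: "countable D" "closure D = UNIV"
    using assms(1) by (auto simp: separable_space_def euclidean_closure_of)
  then have "D \<noteq> {}" by auto
  then obtain Y :: "nat \<Rightarrow> 'a" where Y: "\<And>y N. y \<in> D \<Longrightarrow> \<exists>n\<ge>N. Y (Suc n) = y"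
    using ex_sequence_infinitely_often[OF D(1)] by blast
  \<comment> \<open>In a state \<open>(F, u, f, g, \<rho>)\<close> after step \<open>n\<close>, \<open>f\<close> and \<open>g\<close> must already be
    orthogonal to \<open>Y (Suc n)\<close>, the vector approximated in the next step.\<close>
  define P where "P = (\<lambda>n (F, u, f, g, \<rho>). steerable T F (Y (Suc n)) u f g \<rho> \<and> 0 < \<rho> \<and>
    7 / 8 * \<epsilon>\<^sup>2 \<le> \<rho>\<^sup>2 \<and> cinner (T u) u = l n)"
  define Q where "Q = (\<lambda>n (F, u, f :: 'a, g :: 'a, \<rho> :: real) (F', u', f' :: 'a, g' :: 'a, \<rho>' :: real).
    F' = insert u' F \<and> (\<forall>v\<in>F. cinner v u' = 0) \<and>
    cinner (T u) u' = \<mu> n \<and> cinner (T u') u = \<nu> n \<and>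
    (\<exists>v\<in>cspan F. \<epsilon> * sqrt \<epsilon> / 16 * norm (Y (Suc n) - v) \<le> cmod (cinner (Y (Suc n)) u')))"
  have "\<exists>u f g. steerable T {u} (Y 1) u f g \<epsilon> \<and> cinner (T u) u = l 0"
  proof -
    have "\<exists>x f g. decoupled T {Y 1} x \<and> decoupled T {Y 1} f \<and> decoupled T {Y 1} g \<and>
      norm x = 1 \<and> norm f = 1 \<and> norm g = 1 \<and> cinner x f = 0 \<and> cinner x g = 0 \<and> cinner f g = 0 \<and>
      cinner (T x) x = l 0 \<and> cinner (T x) f = \<epsilon> \<and> cinner (T x) g = 0 \<and>
      cinner (T f) x = 0 \<and> cinner (T g) x = \<epsilon>"
      using W[of 0] assms(5) by (intro cyclic_triple[OF T, where \<delta> = \<epsilon>]) auto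
    then obtain u f g where
        "decoupled T {Y 1} f" "decoupled T {Y 1} g"
        "norm u = 1" "norm f = 1" "norm g = 1" "cinner u f = 0" "cinner u g = 0" "cinner f g = 0"
        "cinner (T u) u = l 0" "cinner (T u) f = \<epsilon>" "cinner (T u) g = 0"
        "cinner (T f) u = 0" "cinner (T g) u = \<epsilon>"
      by blast
    moreover from this have "cinner f u = 0" "cinner g u = 0"
      using cinner_eq_0_sym[of u f] cinner_eq_0_sym[of u g] by simp_all
    ultimately show ?thesis
      by (intro exI[of _ u] exI[of _ f] exI[of _ g])
        (auto simp: steerable_def cinner_unit decoupled_def)
  qed
  then obtain u0 f0 g0 where "steerable T {u0} (Y 1) u0 f0 g0 \<epsilon>" "cinner (T u0) u0 = l 0"
    by blast
  then have P0: "P 0 ({u0}, u0, f0, g0, \<epsilon>)"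
    using assms(5) by (simp add: P_def)
  have step: "\<exists>S'. P (Suc n) S' \<and> Q n S S'" if "P n S" for n S
  proof -
    obtain F u f g \<rho> where S: "S = (F, u, f, g, \<rho>)" by (cases S)
    have "steerable T F (Y (Suc n)) u f g \<rho>" "0 < \<rho>" "7 / 8 * \<epsilon>\<^sup>2 \<le> \<rho>\<^sup>2"
      using that by (simp_all add: P_def S)
    from extension_step[OF T T1 assms(5) \<epsilon> W[of "Suc n"] l[of "Suc n"] small[of n] this,
        of "Y (Suc (Suc n))"]
    obtain u' f' g' \<rho>' where
        "steerable T (insert u' F) (Y (Suc (Suc n))) u' f' g' \<rho>'" "0 < \<rho>'"
        "7 / 8 * \<epsilon>\<^sup>2 \<le> \<rho>'\<^sup>2" "cinner (T u') u' = l (Suc n)" "\<forall>v\<in>F. cinner v u' = 0"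
        "cinner (T u) u' = \<mu> n" "cinner (T u') u = \<nu> n"
        "\<exists>v\<in>cspan F. \<epsilon> * sqrt \<epsilon> / 16 * norm (Y (Suc n) - v) \<le> cmod (cinner (Y (Suc n)) u')"
      by blast
    then show ?thesis
      unfolding P_def Q_def S by (intro exI[of _ "(insert u' F, u', f', g', \<rho>')"]) simp
  qed
  obtain S where S: "\<And>n. P n (S n)" "\<And>n. Q n (S n) (S (Suc n))" and S0: "S 0 = ({u0}, u0, f0, g0, \<epsilon>)"
    using dependent_nat_choice[of "\<lambda>n S. P n S \<and> (n = 0 \<longrightarrow> S = ({u0}, u0, f0, g0, \<epsilon>))" Q] P0 step
    by blast
  define F where "F n = fst (S n)" for n
  define u where "u n = fst (snd (S n))" for n
  have SP: "u n \<in> F n" "cinner (u n) (u n) = 1" "cinner (T (u n)) (u n) = l n" for n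
    using S(1)[of n] by (auto simp: P_def F_def u_def steerable_def split: prod.splits)
  have SQ: "F (Suc n) = insert (u (Suc n)) (F n)" "\<And>v. v \<in> F n \<Longrightarrow> cinner v (u (Suc n)) = 0"
      "cinner (T (u n)) (u (Suc n)) = \<mu> n" "cinner (T (u (Suc n))) (u n) = \<nu> n"
      "\<exists>v\<in>cspan (F n). \<epsilon> * sqrt \<epsilon> / 16 * norm (Y (Suc n) - v) \<le>
        cmod (cinner (Y (Suc n)) (u (Suc n)))" for n
    using S(2)[of n] by (auto simp: Q_def F_def u_def split: prod.splits)
  have F: "F n = u ` {..n}" for n
  proof (induction n)
    case 0
    then show ?case by (simp add: F_def u_def S0)
  next
    case (Suc n)
    then show ?case by (simp add: SQ(1) atMost_Suc)
  qed
  have less: "cinner (u m) (u n) = 0" if mn: "m < n" for m n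
  proof -
    obtain k where "n = Suc k" "m \<le> k" using mn by (cases n) auto
    then show ?thesis using SQ(2)[of "u m" k] by (simp add: F)
  qed
  have ortho: "orthonormal_seq u"
    unfolding orthonormal_seq_def
  proof (intro allI)
    fix m n
    show "cinner (u m) (u n) = (if m = n then 1 else 0)"
      using less[of m n] less[of n m] SP(2)[of n] cinner_eq_0_sym[of "u n" "u m"]
      by (cases m n rule: linorder_cases) auto
  qed
  have "orthonormal_basis_seq u"
  proof (rule orthonormal_basis_if_captures[OF ortho D(2)])
    show "0 < \<epsilon> * sqrt \<epsilon> / 16" using assms(5) by simp
    fix y N assume "y \<in> D"
    then obtain n where n: "n \<ge> N" "Y (Suc n) = y" using Y by blast
    obtain v where v: "v \<in> cspan (F n)"
        "\<epsilon> * sqrt \<epsilon> / 16 * norm (y - v) \<le> cmod (cinner y (u (Suc n)))"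
      using SQ(5)[of n] n(2) by blast
    have "v \<in> cspan (range u)"
      using v(1) complex_vector.span_mono[of "F n" "range u"] by (auto simp: F)
    then show "\<exists>n\<ge>N. \<exists>v\<in>cspan (range u).
        \<epsilon> * sqrt \<epsilon> / 16 * norm (y - v) \<le> cmod (cinner y (u n))"
      using v(2) n(1) by (intro exI[of _ "Suc n"]) auto
  qed
  then show ?thesis using SP(3) SQ(3,4) by blast
qed

end
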